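(* Let $n\geq 4$ be an integer. Then the graph $L(n)$ is Hamilton-connected: for any two distinct vertices $u,v$ of $L(n)$ there is a $u$-$v$ path of length $n(n-1)-1$ in $L(n)$ (i.e., a path from $u$ to $v$ passing through every vertex exactly once).
   Context: Let $n\geq 3$ and $[n]=\{1,2,\dots,n\}$. The graph $B(n)$ has vertex set $\{v : v\subset [n],\ |v|\in\{1,2\}\}$, and two vertices $v,w$ are adjacent iff $v\subset w$ or $w\subset v$. The graph $L(n)$ is the line graph of $B(n)$. Equivalently, the vertices of $L(n)$ are the pairs $[i,ij]:=\{\{i\},\{i,j\}\}$ with $i,j\in[n]$, $i\neq j$ (so $L(n)$ has $n(n-1)$ vertices), and two distinct vertices $[i,ij]$ and $[r,rs]$ are adjacent iff $i=r$ or $\{i,j\}=\{r,s\}$. *)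

theory Defs
  imports "Graph_Theory.Graph_Theory"
begin

text \<open>Finite simple graphs are represented, as in Graph_Theory, by symmetric loop-free
  pair digraphs (locale \<open>pair_graph\<close>): an undirected edge is a pair of opposite arcs.\<close>

text \<open>Adjacency by strict inclusion: comparing a vertex with itself must not create loops.\<close>

definition B_graph :: "nat \<Rightarrow> nat set pair_pre_digraph" where
  "B_graph n =
    (let V = {v. v \<subseteq> {1..n} \<and> card v \<in> {1, 2}}
     in \<lparr> pverts = V, parcs = {(v, w). v \<in> V \<and> w \<in> V \<and> (v \<subset> w \<or> w \<subset> v)} \<rparr>)"

definition undirected_edges :: "'a pair_pre_digraph \<Rightarrow> 'a set set" where
  "undirected_edges G = {{u, v} | u v. (u, v) \<in> parcs G}"

definition line_graph :: "'a pair_pre_digraph \<Rightarrow> 'a set pair_pre_digraph" where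
  "line_graph G =
    \<lparr> pverts = undirected_edges G,
      parcs = {(e, f). e \<in> undirected_edges G \<and> f \<in> undirected_edges G \<and> e \<noteq> f \<and> e \<inter> f \<noteq> {}} \<rparr>"

definition L_graph :: "nat \<Rightarrow> nat set set pair_pre_digraph" where
  "L_graph n = line_graph (B_graph n)"

definition Hamilton_connected :: "('a, 'b) pre_digraph \<Rightarrow> bool" where
  "Hamilton_connected G \<longleftrightarrow>
    (\<forall>u \<in> verts G. \<forall>v \<in> verts G. u \<noteq> v \<longrightarrow>
      (\<exists>p. vpath p G \<and> hd p = u \<and> last p = v \<and> set p = verts G))"

lemma B_graph_arcs:
  "(v, w) \<in> parcs (B_graph n) \<longleftrightarrow>
    (\<exists>i\<in>{1..n}. \<exists>j\<in>{1..n}. i \<noteq> j \<and> (v = {i} \<and> w = {i, j} \<or> w = {i} \<and> v = {i, j}))"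
proof -
  have half: "\<exists>i\<in>{1..n}. \<exists>j\<in>{1..n}. i \<noteq> j \<and> a = {i} \<and> b = {i, j}"
    if "a \<subseteq> {1..n}" "b \<subseteq> {1..n}" "card a \<in> {1, 2}" "card b \<in> {1, 2}" "a \<subset> b" for a b :: "nat set"
  proof -
    have fin: "finite b" using that(2) finite_subset by blast
    have "card a < card b" using fin that(5) by (rule psubset_card_mono)
    then have "card a = 1" "card b = 2" using that(3,4) by auto
    then obtain i where i: "a = {i}" by (meson card_1_singletonE)
    obtain x y where xy: "b = {x, y}" "x \<noteq> y" using \<open>card b = 2\<close> by (meson card_2_iff)
    have mem: "x \<in> {1..n}" "y \<in> {1..n}" using that(2) xy by auto
    have "i = x \<or> i = y" using i xy that(5) by blast
    then show ?thesis
    proof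
      assume "i = x" then show ?thesis using i xy mem by blast
    next
      assume "i = y" then have "a = {y}" "b = {y, x}" using i xy by auto
      then show ?thesis using xy(2) mem by metis
    qed
  qed
  show ?thesis
  proof
    assume "(v, w) \<in> parcs (B_graph n)"
    then show "\<exists>i\<in>{1..n}. \<exists>j\<in>{1..n}. i \<noteq> j \<and> (v = {i} \<and> w = {i, j} \<or> w = {i} \<and> v = {i, j})"
      using half[of v w] half[of w v] unfolding B_graph_def Let_def by simp blast
  next
    assume "\<exists>i\<in>{1..n}. \<exists>j\<in>{1..n}. i \<noteq> j \<and> (v = {i} \<and> w = {i, j} \<or> w = {i} \<and> v = {i, j})"
    then show "(v, w) \<in> parcs (B_graph n)"
      unfolding B_graph_def Let_def by auto
  qed
qed

lemma L_graph_verts: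
  "pverts (L_graph n) = {{{i}, {i, j}} | i j. i \<in> {1..n} \<and> j \<in> {1..n} \<and> i \<noteq> j}"
proof (intro equalityI subsetI)
  fix e assume "e \<in> pverts (L_graph n)"
  then obtain v w where "e = {v, w}" "(v, w) \<in> parcs (B_graph n)"
    unfolding L_graph_def line_graph_def undirected_edges_def by auto
  then obtain i j where "i \<in> {1..n}" "j \<in> {1..n}" "i \<noteq> j"
      "v = {i} \<and> w = {i, j} \<or> w = {i} \<and> v = {i, j}"
    unfolding B_graph_arcs by blast
  moreover from this(4) \<open>e = {v, w}\<close> have "e = {{i}, {i, j}}"
    by (elim disjE conjE) (simp_all only: insert_commute)
  ultimately show "e \<in> {{{i}, {i, j}} | i j. i \<in> {1..n} \<and> j \<in> {1..n} \<and> i \<noteq> j}" by blast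
next
  fix e assume "e \<in> {{{i}, {i, j}} | i j. i \<in> {1..n} \<and> j \<in> {1..n} \<and> i \<noteq> j}"
  then obtain i j where ij: "i \<in> {1..n}" "j \<in> {1..n}" "i \<noteq> j" "e = {{i}, {i, j}}" by blast
  then have "({i}, {i, j}) \<in> parcs (B_graph n)" unfolding B_graph_arcs by blast
  then show "e \<in> pverts (L_graph n)"
    using ij(4) unfolding L_graph_def line_graph_def undirected_edges_def by auto
qed

lemma L_graph_arcs:
  assumes "i \<in> {1..n}" "j \<in> {1..n}" "i \<noteq> j" "r \<in> {1..n}" "s \<in> {1..n}" "r \<noteq> s"
  shows "({{i}, {i, j}}, {{r}, {r, s}}) \<in> parcs (L_graph n) \<longleftrightarrow>
    {{i}, {i, j}} \<noteq> {{r}, {r, s}} \<and> (i = r \<or> {i, j} = {r, s})"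
proof -
  have "{{i}, {i, j}} \<in> pverts (L_graph n)" "{{r}, {r, s}} \<in> pverts (L_graph n)"
    using assms unfolding L_graph_verts by blast+
  moreover have "{{i}, {i, j}} \<inter> {{r}, {r, s}} \<noteq> {} \<longleftrightarrow> i = r \<or> {i, j} = {r, s}"
    using assms by auto
  moreover have "(e, f) \<in> parcs (L_graph n) \<longleftrightarrow>
      e \<in> pverts (L_graph n) \<and> f \<in> pverts (L_graph n) \<and> e \<noteq> f \<and> e \<inter> f \<noteq> {}" for e f
    unfolding L_graph_def line_graph_def by simp
  ultimately show ?thesis by (simp only: simp_thms)
qed

lemma card_L_graph_verts: "card (pverts (L_graph n)) = n * (n - 1)"
proof -
  let ?S = "SIGMA i:{1..n}. {1..n} - {i}"
  have inj: "inj_on (\<lambda>(i, j). {{i}, {i, j}}) ?S"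
  proof (rule inj_onI)
    fix p q assume p: "p \<in> ?S" and q: "q \<in> ?S"
      and eq: "(\<lambda>(i, j). {{i}, {i, j}}) p = (\<lambda>(i, j). {{i}, {i, j}}) q"
    obtain i j r s where pq: "p = (i, j)" "q = (r, s)" by (meson surj_pair)
    have ne: "j \<noteq> i" "s \<noteq> r" using p q pq by auto
    have "{{i}, {i, j}} = {{r}, {r, s}}" using eq unfolding pq by (simp only: case_prod_conv)
    then have "{i} = {r} \<and> {i, j} = {r, s} \<or> {i} = {r, s} \<and> {i, j} = {r}"
      by (simp only: doubleton_eq_iff[of "{i}"])
    then have "i = r \<and> j = s"
    proof
      assume "{i} = {r} \<and> {i, j} = {r, s}"
      then show ?thesis using ne by (auto simp: doubleton_eq_iff)
    next
      assume "{i} = {r, s} \<and> {i, j} = {r}"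
      then have "r = i" "s = i" by blast+
      then show ?thesis using ne by simp
    qed
    then show "p = q" using pq by simp
  qed
  have "pverts (L_graph n) = (\<lambda>(i, j). {{i}, {i, j}}) ` ?S"
  proof (intro equalityI subsetI)
    fix e assume "e \<in> pverts (L_graph n)"
    then obtain i j where "i \<in> {1..n}" "j \<in> {1..n}" "i \<noteq> j" "e = {{i}, {i, j}}"
      unfolding L_graph_verts by blast
    then show "e \<in> (\<lambda>(i, j). {{i}, {i, j}}) ` ?S"
      by (intro image_eqI[of _ _ "(i, j)"]) simp_all
  next
    fix e assume "e \<in> (\<lambda>(i, j). {{i}, {i, j}}) ` ?S"
    then obtain i j where "(i, j) \<in> ?S" "e = {{i}, {i, j}}" by (elim imageE) (simp split: prod.splits)
    then show "e \<in> pverts (L_graph n)" unfolding L_graph_verts by blast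
  qed
  then show ?thesis using inj by (simp add: card_image)
qed

lemma finite_L_graph_verts: "finite (pverts (L_graph n))"
proof -
  have "pverts (L_graph n) \<subseteq> (\<lambda>(i, j). {{i}, {i, j}}) ` ({1..n} \<times> {1..n})"
    unfolding L_graph_verts by auto
  then show ?thesis by (rule finite_subset) simp
qed

lemma pair_graph_L_graph: "pair_graph (L_graph n)"
proof
  let ?G = "L_graph n"
  show fin: "finite (pverts ?G)" by (rule finite_L_graph_verts)
  have sub: "parcs ?G \<subseteq> pverts ?G \<times> pverts ?G"
    unfolding L_graph_def line_graph_def by auto
  then show "finite (parcs ?G)" using fin finite_subset by blast
  show "fst e \<in> pverts ?G" "snd e \<in> pverts ?G" if "e \<in> parcs ?G" for e
    using that sub by auto
  show "fst e \<noteq> snd e" if "e \<in> parcs ?G" for e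
    using that unfolding L_graph_def line_graph_def by auto
  show "symmetric (with_proj ?G)"
    unfolding symmetric_def by (auto simp: sym_def L_graph_def line_graph_def)
qed

end

theory Submission
  imports Defs
begin

text \<open>
  Write $(i, j)$ for the vertex $[i, ij]$. The vertices with first coordinate $i$ form a clique
  $C_i$, and $(i, j)$, $(j, i)$ is the only edge between $C_i$ and $C_j$. A path that enters $C_i$
  from $C_j$ and leaves it for $C_k$ with $k \neq j$ can sweep the whole clique in between. Let the
  endpoints be $(a, b)$ and $(c, d)$.

  If $a \neq c$, sweep the cliques along an ordering of the indices that starts with $a$, ends
  with $c$, has its second entry different from $b$ and its penultimate entry different from $d$.
  Such an ordering exists unless $n = 4$ and $b = d$. If $b = d$, sweep $C_a$, then all of $C_c$ but
  $(c, b)$, then the other cliques with $C_b$ last, and return to $C_c$ through the edge from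
  $(b, c)$ to $(c, b)$. If $a = c$, leave $C_a$ at once through $(b, a)$, sweep the other cliques,
  and finish with the rest of $C_a$.
\<close>

text \<open>A Hamiltonian path from \<open>x\<close> to \<open>y\<close> in the graph that
  \<open>R\<close> induces on \<open>S\<close>. Recording the covered set and both ends lets paths
  over disjoint sets be joined.\<close>

definition spanning_path :: "('a \<Rightarrow> 'a \<Rightarrow> bool) \<Rightarrow> 'a set \<Rightarrow> 'a \<Rightarrow> 'a \<Rightarrow> bool" where
  "spanning_path R S x y \<longleftrightarrow>
    (\<exists>p. p \<noteq> [] \<and> distinct p \<and> successively R p \<and> set p = S \<and> hd p = x \<and> last p = y)"

lemma spanning_path_singleton: "spanning_path R {x} x x"
  unfolding spanning_path_def by (intro exI[of _ "[x]"]) simp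

lemma spanning_path_Un:
  assumes "spanning_path R S x y" "R y x'" "spanning_path R T x' y'" "S \<inter> T = {}"
  shows "spanning_path R (S \<union> T) x y'"
proof -
  obtain p q where
    "p \<noteq> []" "distinct p" "successively R p" "set p = S" "hd p = x" "last p = y"
    "q \<noteq> []" "distinct q" "successively R q" "set q = T" "hd q = x'" "last q = y'"
    using assms(1,3) unfolding spanning_path_def by auto
  then show ?thesis using assms(2,4) unfolding spanning_path_def
    by (intro exI[of _ "p @ q"]) (simp add: successively_append_iff)
qed

lemma ex_distinct_list_with_ends:
  assumes "finite S" "x \<in> S" "y \<in> S" "x \<noteq> y"
  obtains xs where "distinct xs" "set xs = S" "xs \<noteq> []" "tl xs \<noteq> []" "hd xs = x" "last xs = y"
proof -
  obtain zs where "set zs = S - {x, y}" "distinct zs"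
    using finite_distinct_list[of "S - {x, y}"] assms(1) by auto
  then show ?thesis using assms(2-4) by (intro that[of "x # zs @ [y]"]) auto
qed

text \<open>Adjacency of $L(n)$ on ordered pairs: if two pairs have the same two entries but
  different first coordinates, each is the swap of the other.\<close>

definition pair_adj :: "'a \<times> 'a \<Rightarrow> 'a \<times> 'a \<Rightarrow> bool" where
  "pair_adj p q \<longleftrightarrow> p \<noteq> q \<and> (fst p = fst q \<or> q = prod.swap p)"

lemma spanning_path_cross:
  assumes "spanning_path pair_adj S x (i, j)" "spanning_path pair_adj T (j, i) y"
    and "i \<noteq> j" "S \<inter> T = {}"
  shows "spanning_path pair_adj (S \<union> T) x y"
  using assms(1) _ assms(2,4) by (rule spanning_path_Un) (simp add: assms(3) pair_adj_def)

text \<open>Pairs with first coordinate \<open>a\<close> are pairwise adjacent, so any ordering of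
  \<open>S\<close> from \<open>x\<close> to \<open>y\<close> yields a path.\<close>

lemma spanning_path_clique:
  assumes "finite S" "x \<in> S" "y \<in> S" "x \<noteq> y"
  shows "spanning_path pair_adj ({a} \<times> S) (a, x) (a, y)"
proof -
  obtain xs where xs: "distinct xs" "set xs = S" "xs \<noteq> []" "hd xs = x" "last xs = y"
    using ex_distinct_list_with_ends[OF assms] by metis
  have "successively (\<noteq>) xs"
    using xs(1) by (induction xs rule: induct_list012) auto
  then have "successively pair_adj (map (Pair a) xs)"
    by (simp add: successively_map pair_adj_def)
  then show ?thesis using xs unfolding spanning_path_def
    by (intro exI[of _ "map (Pair a) xs"]) (auto simp: distinct_map inj_on_def hd_map last_map)
qed

text \<open>\<open>z\<close> and \<open>w\<close> are the indices of the cliques visited just before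
  and just after the chain. Each clique can be swept because its predecessor and successor differ.
  Only a chain of one clique has both \<open>z\<close> and \<open>w\<close> as its neighbours; a
  longer one may return to where it came from, with \<open>z = w\<close>.\<close>

lemma spanning_path_clique_chain:
  assumes "finite A" "xs \<noteq> []" "distinct xs" "set xs \<subseteq> A"
    and "z \<in> A - set xs" "w \<in> A - set xs" "z \<noteq> w \<or> tl xs \<noteq> []"
  shows "spanning_path pair_adj (SIGMA i:set xs. A - {i}) (hd xs, z) (last xs, w)"
  using assms(2-)
proof (induction xs arbitrary: z rule: induct_list012)
  case 1
  then show ?case by simp
next
  case (2 x)
  moreover have "(SIGMA i:{x}. A - {i}) = {x} \<times> (A - {x})" by auto
  ultimately show ?case
    using spanning_path_clique[of "A - {x}" z w x] assms(1) by simp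
next
  case (3 x y ys)
  have "spanning_path pair_adj ({x} \<times> (A - {x})) (x, z) (x, y)"
    using 3 assms(1) by (intro spanning_path_clique) auto
  \<comment> \<open>The rest of the chain is entered from \<open>x\<close>. Since \<open>w\<close>
    is not in the list, \<open>x\<close> differs from \<open>w\<close>, which also covers
    \<open>ys = []\<close>.\<close>
  moreover have "spanning_path pair_adj (SIGMA i:set (y # ys). A - {i}) (y, x) (last (y # ys), w)"
    using "3.IH"(2)[of x] "3.prems" by auto
  ultimately have "spanning_path pair_adj ({x} \<times> (A - {x}) \<union> (SIGMA i:set (y # ys). A - {i}))
      (x, z) (last (y # ys), w)"
    by (rule spanning_path_cross) (use "3.prems" in auto)
  moreover have "{x} \<times> (A - {x}) \<union> (SIGMA i:set (y # ys). A - {i})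
      = (SIGMA i:set (x # y # ys). A - {i})" by auto
  ultimately show ?case by simp
qed

lemma card_ge_2_obtain:
  assumes "card S \<ge> 2"
  obtains x y where "x \<in> S" "y \<in> S" "x \<noteq> y"
proof -
  obtain T where "T \<subseteq> S" "card T = 2" using assms obtain_subset_with_card_n by metis
  then show ?thesis using that by (auto simp: card_2_iff)
qed

lemma spanning_path_same_clique:
  assumes A: "finite A" "card A \<ge> 4" and mem: "a \<in> A" "b \<in> A - {a}" "d \<in> A - {a}" and "b \<noteq> d"
  shows "spanning_path pair_adj (SIGMA i:A. A - {i}) (a, b) (a, d)"
proof -
  \<comment> \<open>\<open>y\<close> is the last clique before the return to \<open>(a, y)\<close>.
    It avoids \<open>b\<close> because \<open>(a, b)\<close> is already used, and \<open>d\<close>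
    so that the final sweep has distinct ends.\<close>
  have "card (A - {a, b, d}) > 0"
    using A mem \<open>b \<noteq> d\<close> by (subst card_Diff_subset) auto
  then obtain y where y: "y \<in> A - {a, b, d}" by (metis card_gt_0_iff equals0I)
  obtain xs where xs: "distinct xs" "set xs = A - {a}" "xs \<noteq> []" "tl xs \<noteq> []"
      "hd xs = b" "last xs = y"
    using ex_distinct_list_with_ends[of "A - {a}" b y] A mem y by auto
  have "spanning_path pair_adj (SIGMA i:A - {a}. A - {i}) (b, a) (y, a)"
    using spanning_path_clique_chain[of A xs a a] xs A mem by auto
  moreover have "spanning_path pair_adj ({a} \<times> (A - {a, b})) (a, y) (a, d)"
    using A mem y \<open>b \<noteq> d\<close> by (intro spanning_path_clique) auto
  ultimately have "spanning_path pair_adj ((SIGMA i:A - {a}. A - {i}) \<union> {a} \<times> (A - {a, b}))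
      (b, a) (a, d)"
    by (rule spanning_path_cross) (use y in auto)
  then have "spanning_path pair_adj
      ({(a, b)} \<union> ((SIGMA i:A - {a}. A - {i}) \<union> {a} \<times> (A - {a, b}))) (a, b) (a, d)"
    by (rule spanning_path_cross[OF spanning_path_singleton]) (use mem in auto)
  also have "{(a, b)} \<union> ((SIGMA i:A - {a}. A - {i}) \<union> {a} \<times> (A - {a, b})) = (SIGMA i:A. A - {i})"
    using mem by auto
  finally show ?thesis .
qed

text \<open>\<open>s\<close> and \<open>t\<close> are the second and penultimate indices.
  \<open>s \<noteq> b\<close> and \<open>t \<noteq> d\<close> give the first and last sweeps
  distinct ends.\<close>

lemma spanning_path_cliques_in_turn:
  assumes A: "finite A" and mem: "a \<in> A" "c \<in> A" "a \<noteq> c" "b \<in> A - {a}" "d \<in> A - {c}"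
    and s: "s \<in> A - {a, c}" "s \<noteq> b" and t: "t \<in> A - {a, c}" "t \<noteq> d" and "s \<noteq> t"
  shows "spanning_path pair_adj (SIGMA i:A. A - {i}) (a, b) (c, d)"
proof -
  obtain xs where xs: "distinct xs" "set xs = A - {a, c}" "xs \<noteq> []" "tl xs \<noteq> []"
      "hd xs = s" "last xs = t"
    using ex_distinct_list_with_ends[of "A - {a, c}" s t] assms by auto
  have "spanning_path pair_adj ({a} \<times> (A - {a})) (a, b) (a, s)"
    using A mem s by (intro spanning_path_clique) auto
  moreover have "spanning_path pair_adj (SIGMA i:A - {a, c}. A - {i}) (s, a) (t, c)"
    using spanning_path_clique_chain[of A xs a c] xs A mem by auto
  ultimately have "spanning_path pair_adj ({a} \<times> (A - {a}) \<union> (SIGMA i:A - {a, c}. A - {i}))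
      (a, b) (t, c)"
    by (rule spanning_path_cross) (use s in auto)
  moreover have "spanning_path pair_adj ({c} \<times> (A - {c})) (c, t) (c, d)"
    using A mem t by (intro spanning_path_clique) auto
  ultimately have "spanning_path pair_adj
      ({a} \<times> (A - {a}) \<union> (SIGMA i:A - {a, c}. A - {i}) \<union> {c} \<times> (A - {c})) (a, b) (c, d)"
    by (rule spanning_path_cross) (use t mem(3) in auto)
  also have "{a} \<times> (A - {a}) \<union> (SIGMA i:A - {a, c}. A - {i}) \<union> {c} \<times> (A - {c})
      = (SIGMA i:A. A - {i})"
    using mem by auto
  finally show ?thesis .
qed

lemma spanning_path_common_second:
  assumes A: "finite A" "card A \<ge> 4" and mem: "a \<in> A" "c \<in> A" "a \<noteq> c" "b \<in> A - {a, c}"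
  shows "spanning_path pair_adj (SIGMA i:A. A - {i}) (a, b) (c, b)"
proof -
  \<comment> \<open>\<open>y\<close> is the clique visited right after that of \<open>c\<close>,
    which is entered at \<open>(c, a)\<close> and left at \<open>(c, y)\<close>;
    \<open>(c, b)\<close> is kept for the end.\<close>
  have "card (A - {a, b, c}) > 0"
    using A mem by (subst card_Diff_subset) auto
  then obtain y where y: "y \<in> A - {a, b, c}" by (metis card_gt_0_iff equals0I)
  obtain xs where xs: "distinct xs" "set xs = A - {a, c}" "xs \<noteq> []" "tl xs \<noteq> []"
      "hd xs = y" "last xs = b"
    using ex_distinct_list_with_ends[of "A - {a, c}" y b] A mem y by auto
  have "spanning_path pair_adj ({a} \<times> (A - {a})) (a, b) (a, c)"
    using A mem by (intro spanning_path_clique) auto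
  moreover have "spanning_path pair_adj ({c} \<times> (A - {b, c})) (c, a) (c, y)"
    using A mem y by (intro spanning_path_clique) auto
  ultimately have "spanning_path pair_adj ({a} \<times> (A - {a}) \<union> {c} \<times> (A - {b, c})) (a, b) (c, y)"
    by (rule spanning_path_cross) (use mem in auto)
  \<comment> \<open>The chain starts from and returns to the clique of \<open>c\<close>, so
    \<open>c\<close> takes both outer roles.\<close>
  moreover have "spanning_path pair_adj (SIGMA i:A - {a, c}. A - {i}) (y, c) (b, c)"
    using spanning_path_clique_chain[of A xs c c] xs A mem by auto
  ultimately have "spanning_path pair_adj
      ({a} \<times> (A - {a}) \<union> {c} \<times> (A - {b, c}) \<union> (SIGMA i:A - {a, c}. A - {i})) (a, b) (b, c)"
    by (rule spanning_path_cross) (use y in auto)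
  then have "spanning_path pair_adj
      ({a} \<times> (A - {a}) \<union> {c} \<times> (A - {b, c}) \<union> (SIGMA i:A - {a, c}. A - {i}) \<union> {(c, b)})
      (a, b) (c, b)"
    by (rule spanning_path_cross[OF _ spanning_path_singleton]) (use mem in auto)
  also have "{a} \<times> (A - {a}) \<union> {c} \<times> (A - {b, c}) \<union> (SIGMA i:A - {a, c}. A - {i}) \<union> {(c, b)}
      = (SIGMA i:A. A - {i})"
    using mem by auto
  finally show ?thesis .
qed

lemma spanning_path_pairs:
  assumes A: "finite A" "card A \<ge> 4" and mem: "a \<in> A" "b \<in> A - {a}" "c \<in> A" "d \<in> A - {c}"
    and "(a, b) \<noteq> (c, d)"
  shows "spanning_path pair_adj (SIGMA i:A. A - {i}) (a, b) (c, d)"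
proof (cases "a = c")
  case True
  then show ?thesis using spanning_path_same_clique[of A a b d] assms by auto
next
  case False
  show ?thesis
  proof (cases "b = d")
    case True
    \<comment> \<open>The common value lies outside \<open>{a, c}\<close>, as
      \<open>b \<noteq> a\<close> and \<open>d \<noteq> c\<close>.\<close>
    then show ?thesis using spanning_path_common_second[of A a c b] assms False by auto
  next
    case neq: False
    have "card (A - {a, c}) \<ge> 2"
      using A mem False by (subst card_Diff_subset) auto
    then obtain x y where xy: "x \<in> A - {a, c}" "y \<in> A - {a, c}" "x \<noteq> y"
      by (rule card_ge_2_obtain)
    \<comment> \<open>If both orders of \<open>x\<close> and \<open>y\<close> failed, then
      \<open>x = y\<close> or \<open>b = d\<close> would follow.\<close>
    then have "x \<noteq> b \<and> y \<noteq> d \<or> y \<noteq> b \<and> x \<noteq> d" using neq by auto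
    then show ?thesis
      using spanning_path_cliques_in_turn[of A a c b d] A mem False xy by metis
  qed
qed

text \<open>This is Kuratowski's encoding of the ordered pair, hence injective on all pairs, even
  those with equal entries.\<close>

definition L_vertex :: "nat \<times> nat \<Rightarrow> nat set set" where
  "L_vertex p = {{fst p}, {fst p, snd p}}"

lemma inj_L_vertex: "inj L_vertex"
  by (rule injI) (auto simp: L_vertex_def doubleton_eq_iff prod_eq_iff)

lemma L_vertex_image: "L_vertex ` (SIGMA i:{1..n}. {1..n} - {i}) = pverts (L_graph n)"
proof (intro equalityI subsetI)
  fix e assume "e \<in> pverts (L_graph n)"
  then obtain i j where "i \<in> {1..n}" "j \<in> {1..n}" "i \<noteq> j" "e = {{i}, {i, j}}"
    unfolding L_graph_verts by blast
  then show "e \<in> L_vertex ` (SIGMA i:{1..n}. {1..n} - {i})"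
    by (intro image_eqI[of _ _ "(i, j)"]) (simp_all add: L_vertex_def)
next
  fix e assume "e \<in> L_vertex ` (SIGMA i:{1..n}. {1..n} - {i})"
  then obtain i j where "i \<in> {1..n}" "j \<in> {1..n} - {i}" "e = L_vertex (i, j)" by blast
  then have "i \<in> {1..n}" "j \<in> {1..n}" "i \<noteq> j" "e = {{i}, {i, j}}"
    by (simp_all add: L_vertex_def)
  then show "e \<in> pverts (L_graph n)"
    unfolding L_graph_verts by blast
qed

lemma L_vertex_arc:
  assumes "p \<in> (SIGMA i:{1..n}. {1..n} - {i})" "q \<in> (SIGMA i:{1..n}. {1..n} - {i})" "pair_adj p q"
  shows "(L_vertex p, L_vertex q) \<in> parcs (L_graph n)"
proof -
  have "L_vertex p \<noteq> L_vertex q"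
    using assms(3) inj_L_vertex by (auto simp: pair_adj_def inj_eq)
  then show ?thesis
    using assms L_graph_arcs[of "fst p" n "snd p" "fst q" "snd q"]
    by (auto simp: L_vertex_def pair_adj_def insert_commute)
qed

lemma vwalkI_successively:
  assumes "p \<noteq> []" "set p \<subseteq> pverts G" "successively (\<lambda>x y. (x, y) \<in> parcs G) p"
  shows "vwalk p (with_proj G)"
  using assms by (induction p rule: induct_list012) (auto simp: vwalk_def)

lemma L_graph_Hamilton_path:
  assumes "n \<ge> 4" "u \<in> pverts (L_graph n)" "v \<in> pverts (L_graph n)" "u \<noteq> v"
  shows "\<exists>p. vpath p (with_proj (L_graph n)) \<and> hd p = u \<and> last p = v \<and> set p = pverts (L_graph n)"
proof -
  let ?S = "SIGMA i:{1..n}. {1..n} - {i}"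
  obtain x y where xy: "x \<in> ?S" "y \<in> ?S" "u = L_vertex x" "v = L_vertex y"
    using assms(2,3) unfolding L_vertex_image[symmetric] by blast
  then have "spanning_path pair_adj ?S x y"
    using spanning_path_pairs[of "{1..n}" "fst x" "snd x" "fst y" "snd y"] assms(1,4)
    by (cases x; cases y) auto
  then obtain p where p: "p \<noteq> []" "distinct p" "successively pair_adj p" "set p = ?S"
      "hd p = x" "last p = y"
    unfolding spanning_path_def by blast
  have "successively (\<lambda>a b. (a, b) \<in> parcs (L_graph n)) (map L_vertex p)"
    unfolding successively_map
    by (rule successively_mono[OF p(3)]) (simp only: p(4) L_vertex_arc)
  moreover have "set (map L_vertex p) = pverts (L_graph n)"
    using p(4) L_vertex_image by simp
  ultimately have "vwalk (map L_vertex p) (with_proj (L_graph n))"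
    using p(1) by (intro vwalkI_successively) simp_all
  moreover have "distinct (map L_vertex p)"
    using p(2) inj_L_vertex by (metis distinct_map inj_on_subset subset_UNIV)
  ultimately have "vpath (map L_vertex p) (with_proj (L_graph n))"
    by (simp add: vpath_def)
  then show ?thesis
    using p(1,4-) xy(3,4) L_vertex_image[of n]
    by (intro exI[of _ "map L_vertex p"]) (simp add: hd_map last_map)
qed

theorem theorem2p4:
  fixes n :: nat
  assumes "n \<ge> 4"
  shows "Hamilton_connected (with_proj (L_graph n)) \<and>
    (\<forall>u \<in> pverts (L_graph n). \<forall>v \<in> pverts (L_graph n). u \<noteq> v \<longrightarrow>
      (\<exists>p. vpath p (with_proj (L_graph n)) \<and> hd p = u \<and> last p = v \<and>
        vwalk_length p = n * (n - 1) - 1))"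
proof -
  \<comment> \<open>A path visiting each of the $n(n-1)$ vertices once has one arc fewer than
    vertices, so the length claim follows from spanning.\<close>
  have "vwalk_length p = n * (n - 1) - 1"
    if "vpath p (with_proj (L_graph n))" "set p = pverts (L_graph n)" for p
    using that card_L_graph_verts[of n] distinct_card[of p]
    by (simp add: vpath_def)
  then show ?thesis
    unfolding Hamilton_connected_def using L_graph_Hamilton_path[OF assms]
    by (metis with_proj_simps(1))
qed

end
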